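(* For positive integers $n,k$, $$F_{n,k}(13/2)=\sum_{\lambda\in D_{n-1,k}} r^{|n-\lambda|}\,s^{|\lambda|}.$$
   Context: A set partition $\pi=B_1/B_2/\cdots/B_k$ of $[n]=\{1,\dots,n\}$ is written with its blocks ordered so that $\min B_1<\min B_2<\cdots<\min B_k$. For $S\subseteq[n]$, restrict $\pi$ to $S$ by taking the nonempty intersections $B_i\cap S$, and standardize by replacing the smallest element of $S$ by $1$, the second smallest by $2$, etc. The partition $\pi$ contains a partition $\omega$ if the standardized restriction to some $S$ equals $\omega$; otherwise $\pi$ avoids $\omega$. $\Pi_{n,k}(\omega)$ is the set of partitions of $[n]$ with exactly $k$ blocks that avoid $\omega$. Here $13/2$ denotes the partition $\{\{1,3\},\{2\}\}$ of $[3]$. The restricted growth function (RGF) of $\pi$ is the word $w(\pi)=a_1\cdots a_n$ with $a_i=j$ iff $i\in B_j$. For a word $w=a_1\cdots a_n$ put $lb(a_j)=\#\{a_i: i<j,\ a_i>a_j\}$, $ls(a_j)=\#\{a_i: i<j,\ a_i<a_j\}$, $rb(a_j)=\#\{a_i: i>j,\ a_i>a_j\}$, $rs(a_j)=\#\{a_i: i>j,\ a_i<a_j\}$, where each is the cardinality of a set of values (distinct letters are counted once), and let $lb(w)=\sum_j lb(a_j)$, and similarly for $ls,rb,rs$. For a partition $\pi$, $lb(\pi)=lb(w(\pi))$, etc. $$F_{n,k}(\omega)=F_{n,k}(\omega;q,r,s,t)=\sum_{\pi\in\Pi_{n,k}(\omega)}q^{lb(\pi)}r^{ls(\pi)}s^{rb(\pi)}t^{rs(\pi)}.$$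 $D_{n-1,k}$ denotes the set of all integer partitions $\lambda=(\lambda_1,\dots,\lambda_k)$ with exactly $k$ distinct parts, each of size at most $n-1$. $|\lambda|=\sum_i\lambda_i$, and $n-\lambda$ is the partition with parts $n-\lambda_i$, so $|n-\lambda|=\sum_i(n-\lambda_i)$.
   Formalization: The sum is taken over D_{n-1,k-1} (exactly k-1 distinct parts, each at most n-1) instead of D_{n-1,k}; as printed the identity is false, e.g. for n=2, k=1 the left side is 1 while the right side is rs. *)

theory Defs
  imports Complex_Main "HOL-Library.Disjoint_Sets"
begin

text \<open>A set partition of \<open>{1..n}\<close> is a \<open>P :: nat set set\<close> with \<open>partition_on {1..n} P\<close>;
  in particular all blocks are nonempty.\<close>

definition restrict_partition :: "nat set \<Rightarrow> nat set set \<Rightarrow> nat set set" where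
  "restrict_partition S P = {B \<inter> S | B. B \<in> P \<and> B \<inter> S \<noteq> {}}"

text \<open>The rank of \<open>x\<close> in \<open>S\<close>: the smallest element of \<open>S\<close> is sent to 1, the next to 2, etc.\<close>

definition std :: "nat set \<Rightarrow> nat \<Rightarrow> nat" where
  "std S x = card {y \<in> S. y \<le> x}"

definition std_restriction :: "nat set \<Rightarrow> nat set set \<Rightarrow> nat set set" where
  "std_restriction S P = (\<lambda>B. std S ` B) ` restrict_partition S P"

definition contains_pattern :: "nat \<Rightarrow> nat set set \<Rightarrow> nat set set \<Rightarrow> bool" where
  "contains_pattern n P \<omega> \<longleftrightarrow> (\<exists>S\<subseteq>{1..n}. std_restriction S P = \<omega>)"

definition avoiders :: "nat \<Rightarrow> nat \<Rightarrow> nat set set \<Rightarrow> nat set set set" where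
  "avoiders n k \<omega> = {P. partition_on {1..n} P \<and> card P = k \<and> \<not> contains_pattern n P \<omega>}"

definition block_list :: "nat set set \<Rightarrow> nat set list" where
  "block_list P = sorted_key_list_of_set Min P"

text \<open>Isabelle lists are indexed from 0: the block \<open>B\<^sub>j\<close> is \<open>block_list P ! (j - 1)\<close>, and the letter
  \<open>a\<^sub>i\<close> of the restricted growth function is \<open>rgf n P ! (i - 1)\<close>.\<close>

definition rgf :: "nat \<Rightarrow> nat set set \<Rightarrow> nat list" where
  "rgf n P = map (\<lambda>i. THE j. 1 \<le> j \<and> j \<le> length (block_list P) \<and> i \<in> block_list P ! (j - 1)) [1..<Suc n]"

text \<open>Each letter contributes the number of distinct values (not positions) in the given set.\<close>

definition lb :: "nat list \<Rightarrow> nat" where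
  "lb w = (\<Sum>j<length w. card {w ! i | i. i < j \<and> w ! i > w ! j})"

definition ls :: "nat list \<Rightarrow> nat" where
  "ls w = (\<Sum>j<length w. card {w ! i | i. i < j \<and> w ! i < w ! j})"

definition rb :: "nat list \<Rightarrow> nat" where
  "rb w = (\<Sum>j<length w. card {w ! i | i. j < i \<and> i < length w \<and> w ! i > w ! j})"

definition rs :: "nat list \<Rightarrow> nat" where
  "rs w = (\<Sum>j<length w. card {w ! i | i. j < i \<and> i < length w \<and> w ! i < w ! j})"

text \<open>The generating function, evaluated at elements of a commutative semiring. An identity
  for all \<open>q r s t\<close> in all such semirings is the same as an identity of polynomials: take the
  semiring to be a polynomial ring and \<open>q r s t\<close> its indeterminates.\<close>

definition F :: "nat \<Rightarrow> nat \<Rightarrow> nat set set \<Rightarrow> 'a \<Rightarrow> 'a \<Rightarrow> 'a \<Rightarrow> 'a \<Rightarrow> 'a::comm_semiring_1" where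
  "F n k \<omega> q r s t =
     (\<Sum>P\<in>avoiders n k \<omega>. q ^ lb (rgf n P) * r ^ ls (rgf n P) * s ^ rb (rgf n P) * t ^ rs (rgf n P))"

text \<open>Integer partitions into \<open>k\<close> distinct parts, each at most \<open>m\<close>, as strictly decreasing lists
  of positive integers. The empty partition is the only one with \<open>k = 0\<close>.\<close>

definition distinct_partitions :: "nat \<Rightarrow> nat \<Rightarrow> nat list set" where
  "distinct_partitions m k =
     {ps. length ps = k \<and> sorted_wrt (>) ps \<and> (\<forall>x\<in>set ps. 1 \<le> x \<and> x \<le> m)}"

text \<open>The partition with parts \<open>n - p\<^sub>i\<close>, listed in decreasing order; used for parts at most \<open>n\<close>,
  so the subtraction does not truncate.\<close>

definition complement_partition :: "nat \<Rightarrow> nat list \<Rightarrow> nat list" where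
  "complement_partition n ps = rev (map (\<lambda>x. n - x) ps)"

end

(* The partitions avoiding 13/2 are those whose blocks are intervals. Such a partition of [n] is
   determined by the set C of elements c < n at which a block ends, and the letter of x in its
   restricted growth function is 1 + #{c in C. c < x}. This word is weakly increasing, so lb and rs
   vanish; ls and rb count the pairs of a letter and an end c with c < x and x <= c respectively,
   so that each c in C contributes n - c to ls and c to rb. *)

theory Submission
  imports Defs
begin

section \<open>Avoidance of 13/2\<close>

lemma std_less_imp_less:
  assumes "finite S" "std S x < std S y"
  shows "x < y"
proof (rule ccontr)
  assume "\<not> x < y"
  then have "{z \<in> S. z \<le> y} \<subseteq> {z \<in> S. z \<le> x}" by auto
  then have "std S y \<le> std S x"
    unfolding std_def using assms(1) by (intro card_mono) auto
  then show False using assms(2) by simp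
qed

text \<open>Negated, the right-hand side says that every block is convex, the form in which
  avoidance is used from here on. The block of \<open>y\<close> need not be named: disjointness
  makes any block of \<open>y\<close> differ from \<open>B\<close>.\<close>

lemma contains_13_2_iff:
  assumes P: "partition_on {1..n} P"
  shows "contains_pattern n P {{1, 3}, {2}} \<longleftrightarrow>
    (\<exists>x y z B. x < y \<and> y < z \<and> B \<in> P \<and> x \<in> B \<and> z \<in> B \<and> y \<notin> B)"
proof
  assume "contains_pattern n P {{1, 3}, {2}}"
  then obtain S where S: "S \<subseteq> {1..n}" "std_restriction S P = {{1, 3}, {2}}"
    unfolding contains_pattern_def by blast
  have fin: "finite S" using S(1) finite_subset by blast
  have "{1, 3} \<in> std_restriction S P" "{2} \<in> std_restriction S P" using S(2) by auto
  moreover have "\<exists>B\<in>P. A = std S ` (B \<inter> S)" if "A \<in> std_restriction S P" for A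
    using that unfolding std_restriction_def restrict_partition_def by blast
  ultimately obtain B B' where B: "B \<in> P" "std S ` (B \<inter> S) = {1, 3}"
    and B': "std S ` (B' \<inter> S) = {2}"
    by metis
  \<comment> \<open>The witnesses are elements of rank 1, 3 and 2; ranks increase with the elements,
    so \<open>x < y < z\<close>.\<close>
  obtain x where x: "x \<in> B" "std S x = 1" using B(2) by (metis IntD1 imageE insertI1)
  obtain z where z: "z \<in> B" "std S z = 3" using B(2) by (metis IntD1 imageE insertI1 insertI2)
  obtain y where y: "y \<in> S" "std S y = 2" using B' by (metis IntD2 imageE insertI1)
  have "y \<notin> B"
  proof
    assume "y \<in> B"
    then have "std S y \<in> {1, 3}" using B(2) y(1) by blast
    then show False using y(2) by simp
  qed
  moreover have "x < y" "y < z"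
    using std_less_imp_less[OF fin] x y z by simp_all
  ultimately show "\<exists>x y z B. x < y \<and> y < z \<and> B \<in> P \<and> x \<in> B \<and> z \<in> B \<and> y \<notin> B"
    using B(1) x(1) z(1) by blast
next
  assume "\<exists>x y z B. x < y \<and> y < z \<and> B \<in> P \<and> x \<in> B \<and> z \<in> B \<and> y \<notin> B"
  then obtain x y z B where xyz: "x < y" "y < z" and B: "B \<in> P" "x \<in> B" "z \<in> B" "y \<notin> B" by blast
  have un: "\<Union>P = {1..n}" using P by (simp add: partition_on_def)
  have xz: "x \<in> {1..n}" "z \<in> {1..n}" using un B by blast+
  then have y: "y \<in> {1..n}" using xyz by auto
  then obtain B' where B': "B' \<in> P" "y \<in> B'" using un by blast
  have disj: "C = D" if "C \<in> P" "D \<in> P" "u \<in> C" "u \<in> D" for C D u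
    using partition_onD2[OF P] that unfolding disjoint_def by blast
  let ?S = "{x, y, z}"
  \<comment> \<open>Only two blocks meet \<open>?S\<close>: by disjointness, a block containing
    \<open>y\<close> is \<open>B'\<close> and one containing \<open>x\<close> or \<open>z\<close> is
    \<open>B\<close>.\<close>
  have "restrict_partition ?S P = {{x, z}, {y}}"
  proof
    show "restrict_partition ?S P \<subseteq> {{x, z}, {y}}"
    proof
      fix A assume "A \<in> restrict_partition ?S P"
      then obtain D where D: "D \<in> P" "A = D \<inter> ?S" "A \<noteq> {}"
        unfolding restrict_partition_def by auto
      show "A \<in> {{x, z}, {y}}"
      proof (cases "y \<in> D")
        case True
        then have "D = B'" using disj D(1) B' by blast
        then have "x \<notin> D" "z \<notin> D" using disj B B' by blast+
        then show ?thesis using D True by auto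
      next
        case False
        then have "x \<in> D \<or> z \<in> D" using D by auto
        then have "D = B" using disj D(1) B by blast
        then show ?thesis using D B by auto
      qed
    qed
    have "{x, z} = B \<inter> ?S" using B by auto
    moreover have "{y} = B' \<inter> ?S" using disj B B' by auto
    ultimately show "{{x, z}, {y}} \<subseteq> restrict_partition ?S P"
      unfolding restrict_partition_def using B(1) B'(1) by blast
  qed
  moreover have "std ?S x = 1" "std ?S y = 2" "std ?S z = 3"
  proof -
    have "{v \<in> ?S. v \<le> x} = {x}" "{v \<in> ?S. v \<le> y} = {x, y}" "{v \<in> ?S. v \<le> z} = {x, y, z}"
      using xyz by auto
    then show "std ?S x = 1" "std ?S y = 2" "std ?S z = 3"
      unfolding std_def using xyz by auto
  qed
  ultimately have "std_restriction ?S P = {{1, 3}, {2}}"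
    unfolding std_restriction_def by simp
  then show "contains_pattern n P {{1, 3}, {2}}"
    unfolding contains_pattern_def using xz y by (intro exI[of _ ?S]) simp
qed

section \<open>Partitions into intervals\<close>

text \<open>When the blocks are intervals ending at the cuts, this is the zero-based index of the
  block of \<open>x\<close>.\<close>

definition cuts_below :: "nat set \<Rightarrow> nat \<Rightarrow> nat" where
  "cuts_below C x = card {c \<in> C. c < x}"

definition layer :: "nat \<Rightarrow> nat set \<Rightarrow> nat \<Rightarrow> nat set" where
  "layer n C j = {x \<in> {1..n}. cuts_below C x = j}"

definition layered :: "nat \<Rightarrow> nat set \<Rightarrow> nat set set" where
  "layered n C = layer n C ` {..card C}"

text \<open>For blocks that are intervals, these are the ends of blocks. The point \<open>n\<close>
  is left out although the last block ends there, so there is one cut fewer than there are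
  blocks.\<close>

definition cuts :: "nat \<Rightarrow> nat set set \<Rightarrow> nat set" where
  "cuts n P = {c \<in> {1..<n}. \<not> (\<exists>B\<in>P. c \<in> B \<and> Suc c \<in> B)}"

text \<open>Serves to compute \<open>block_list\<close>, with \<open>Min\<close> as key. Strictly
  increasing keys exclude repetitions, and then the sorted enumeration is unique.\<close>

lemma (in linorder) sorted_key_list_of_set_eqI:
  assumes "inj_on f A" "sorted_wrt (<) (map f xs)" "set xs = A"
  shows "sorted_key_list_of_set f A = xs"
proof -
  \<comment> \<open>The carrier is \<open>A\<close> itself because \<open>Min\<close> is injective
    only on the blocks at hand, not on all sets.\<close>
  interpret key: folding_insort_key "(\<le>)" "(<)" A f
    by unfold_locales (fact assms(1))
  have "distinct xs" using assms(2) by (simp add: strict_sorted_iff distinct_map)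
  then show ?thesis
    using key.sorted_key_list_of_set_unique[of A xs] assms distinct_card[of xs] by auto
qed

section \<open>Counting the cuts below a point\<close>

lemma cuts_below_mono: "x \<le> y \<Longrightarrow> cuts_below C x \<le> cuts_below C y"
  unfolding cuts_below_def by (intro card_mono) auto

lemma cuts_below_less_imp_less: "cuts_below C x < cuts_below C y \<Longrightarrow> x < y"
  by (meson cuts_below_mono leD not_le_imp_less)

lemma cuts_below_Suc:
  "cuts_below C (Suc x) = (if x \<in> C then Suc (cuts_below C x) else cuts_below C x)"
proof -
  have "{c \<in> C. c < Suc x} = (if x \<in> C then insert x {c \<in> C. c < x} else {c \<in> C. c < x})"
    by (auto simp: less_Suc_eq)
  then show ?thesis unfolding cuts_below_def by simp
qed

text \<open>The two sets counted are nested and finite, so equal cardinality means equality. The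
  interval is half-open because a cut \<open>c\<close> separates \<open>c\<close> from
  \<open>Suc c\<close>: a cut at \<open>x\<close> matters, one at \<open>y\<close> does not.\<close>

lemma cuts_below_eq_iff:
  assumes "x \<le> y"
  shows "cuts_below C x = cuts_below C y \<longleftrightarrow> C \<inter> {x..<y} = {}"
proof -
  have sub: "{c \<in> C. c < x} \<subseteq> {c \<in> C. c < y}" using assms by auto
  have fin: "finite {c \<in> C. c < y}" by simp
  have "cuts_below C x = cuts_below C y \<longleftrightarrow> {c \<in> C. c < x} = {c \<in> C. c < y}"
    unfolding cuts_below_def
  proof
    assume "card {c \<in> C. c < x} = card {c \<in> C. c < y}"
    then show "{c \<in> C. c < x} = {c \<in> C. c < y}" by (rule card_subset_eq[OF fin sub])
  qed (rule arg_cong[where f = card])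
  also have "\<dots> \<longleftrightarrow> (\<forall>c\<in>C. c < y \<longrightarrow> c < x)" using sub by blast
  also have "\<dots> \<longleftrightarrow> C \<inter> {x..<y} = {}" by (auto simp: not_le[symmetric])
  finally show ?thesis .
qed

text \<open>A discrete intermediate value argument: the count is 0 at 1, since 0 is no cut, and
  rises by at most one at each step.\<close>

lemma cuts_below_image:
  assumes "m \<ge> 1" "0 \<notin> C"
  shows "cuts_below C ` {1..m} = {..cuts_below C m}"
  using assms(1)
proof (induction m rule: dec_induct)
  case base
  have "{c \<in> C. c < 1} = {}" using assms(2) by auto
  then have "cuts_below C 1 = 0" unfolding cuts_below_def by (metis card.empty)
  then show ?case by simp
next
  case (step m)
  have "{1..Suc m} = insert (Suc m) {1..m}" by auto
  then show ?case using step.IH by (auto simp: cuts_below_Suc)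
qed

section \<open>The interval partition with a prescribed set of cuts\<close>

context
  fixes n :: nat and C :: "nat set"
  assumes n: "n \<ge> 1" and C: "C \<subseteq> {1..<n}"
begin

lemma cuts_below_range: "cuts_below C ` {1..n} = {..card C}"
proof -
  have "{c \<in> C. c < n} = C" using C by auto
  moreover have "0 \<notin> C" using C by auto
  ultimately show ?thesis using cuts_below_image[OF n] by (simp add: cuts_below_def)
qed

lemma cuts_below_le_card: "x \<in> {1..n} \<Longrightarrow> cuts_below C x \<le> card C"
  using cuts_below_range by blast

lemma layer_nonempty: "j \<le> card C \<Longrightarrow> layer n C j \<noteq> {}"
  using cuts_below_range unfolding layer_def
  by (smt (verit) atMost_iff empty_iff imageE mem_Collect_eq)

lemma layer_inj: "inj_on (layer n C) {..card C}"
proof (rule inj_onI)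
  fix i j assume ij: "i \<in> {..card C}" "j \<in> {..card C}" "layer n C i = layer n C j"
  obtain x where "x \<in> layer n C i" using layer_nonempty ij(1) by blast
  then show "i = j" using ij(3) by (auto simp: layer_def)
qed

lemma card_layered: "card (layered n C) = Suc (card C)"
  unfolding layered_def using card_image[OF layer_inj] by simp

lemma partition_on_layered: "partition_on {1..n} (layered n C)"
proof (rule partition_onI)
  show "\<Union>(layered n C) = {1..n}"
    using cuts_below_le_card by (auto simp: layered_def layer_def)
  show "disjnt p q" if "p \<in> layered n C" "q \<in> layered n C" "p \<noteq> q" for p q
    using that by (auto simp: layered_def layer_def disjnt_def)
  show "{} \<notin> layered n C"
    using layer_nonempty by (auto simp: layered_def)
qed

lemma layered_avoids: "\<not> contains_pattern n (layered n C) {{1, 3}, {2}}"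
proof
  assume "contains_pattern n (layered n C) {{1, 3}, {2}}"
  then obtain x y z B where *: "x < y" "y < z" "B \<in> layered n C" "x \<in> B" "z \<in> B" "y \<notin> B"
    using contains_13_2_iff[OF partition_on_layered] by blast
  then obtain j where j: "B = layer n C j" by (auto simp: layered_def)
  have "cuts_below C x \<le> cuts_below C y" "cuts_below C y \<le> cuts_below C z"
    using * by (simp_all add: cuts_below_mono)
  then show False using * j by (auto simp: layer_def)
qed

text \<open>The count jumps between \<open>c\<close> and \<open>Suc c\<close> exactly when
  \<open>c\<close> lies in \<open>C\<close>, so these are the only places where neighbours are
  separated.\<close>

lemma cuts_layered: "cuts n (layered n C) = C"
proof -
  have "(\<exists>B\<in>layered n C. c \<in> B \<and> Suc c \<in> B) \<longleftrightarrow> c \<notin> C" if "c \<in> {1..<n}" for c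
    using that cuts_below_le_card[of c] by (auto simp: layered_def layer_def cuts_below_Suc)
  then show ?thesis using C unfolding cuts_def by blast
qed

text \<open>The minima have counts \<open>i\<close> and \<open>j\<close>, and a smaller count forces
  a smaller element. Thus the layers are already numbered in the order of their minima.\<close>

lemma Min_layer_less:
  assumes "i < j" "j \<le> card C"
  shows "Min (layer n C i) < Min (layer n C j)"
proof -
  have fin: "finite (layer n C a)" for a by (simp add: layer_def)
  have "Min (layer n C i) \<in> layer n C i" "Min (layer n C j) \<in> layer n C j"
    using assms layer_nonempty fin by (auto intro!: Min_in)
  then have "cuts_below C (Min (layer n C i)) = i" "cuts_below C (Min (layer n C j)) = j"
    by (simp_all only: layer_def mem_Collect_eq)
  then show ?thesis using assms(1) cuts_below_less_imp_less[of C] by metis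
qed

lemma block_list_layered: "block_list (layered n C) = map (layer n C) [0..<Suc (card C)]"
proof -
  have inj: "inj_on Min (layered n C)"
  proof (rule inj_onI)
    fix A B assume "A \<in> layered n C" "B \<in> layered n C" and eq: "Min A = Min B"
    then obtain i j where ij: "i \<le> card C" "j \<le> card C" "A = layer n C i" "B = layer n C j"
      by (auto simp: layered_def)
    then show "A = B"
      using Min_layer_less[of i j] Min_layer_less[of j i] eq by (cases i j rule: linorder_cases) auto
  qed
  have sorted: "sorted_wrt (<) (map Min (map (layer n C) [0..<Suc (card C)]))"
    unfolding sorted_wrt_map
    by (rule sorted_wrt_mono_rel[OF _ sorted_wrt_upt]) (auto intro!: Min_layer_less)
  have set: "set (map (layer n C) [0..<Suc (card C)]) = layered n C"
    unfolding layered_def set_map set_upt atLeast0LessThan lessThan_Suc_atMost ..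
  show ?thesis
    unfolding block_list_def by (rule sorted_key_list_of_set_eqI[OF inj sorted set])
qed

lemma rgf_layered: "rgf n (layered n C) = map (\<lambda>i. Suc (cuts_below C i)) [1..<Suc n]"
  unfolding rgf_def
proof (rule map_cong[OF refl])
  fix i assume "i \<in> set [1..<Suc n]"
  then have i: "i \<in> {1..n}" by auto
  show "(THE j. 1 \<le> j \<and> j \<le> length (block_list (layered n C)) \<and>
      i \<in> block_list (layered n C) ! (j - 1)) = Suc (cuts_below C i)"
  proof (rule the_equality)
    show "1 \<le> Suc (cuts_below C i) \<and> Suc (cuts_below C i) \<le> length (block_list (layered n C)) \<and>
        i \<in> block_list (layered n C) ! (Suc (cuts_below C i) - 1)"
      using i cuts_below_le_card[OF i]
      by (auto simp: block_list_layered layer_def nth_append simp del: upt_Suc)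
  next
    \<comment> \<open>Lying in layer \<open>j - 1\<close> means that
      \<open>cuts_below C i = j - 1\<close>, and \<open>1 <= j\<close> allows solving for
      \<open>j\<close>.\<close>
    fix j assume "1 \<le> j \<and> j \<le> length (block_list (layered n C)) \<and>
        i \<in> block_list (layered n C) ! (j - 1)"
    then show "j = Suc (cuts_below C i)"
      by (auto simp: block_list_layered layer_def simp del: upt_Suc)
  qed
qed

end

text \<open>For convex blocks, two elements share a block iff no cut lies between them, that is, iff
  their counts agree. So the blocks are the level sets of \<open>cuts_below\<close>.\<close>

lemma convex_partition_layered:
  assumes n: "n \<ge> 1" and P: "partition_on {1..n} P"
    and convex: "\<And>x y z B. x < y \<Longrightarrow> y < z \<Longrightarrow> B \<in> P \<Longrightarrow> x \<in> B \<Longrightarrow> z \<in> B \<Longrightarrow> y \<in> B"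
  shows "layered n (cuts n P) = P"
proof -
  define C where "C = cuts n P"
  have un: "\<Union>P = {1..n}" using P by (simp add: partition_on_def)
  have disj: "A = B" if "A \<in> P" "B \<in> P" "u \<in> A" "u \<in> B" for A B u
    using partition_onD2[OF P] that unfolding disjoint_def by blast
  have same_block: "y \<in> B \<longleftrightarrow> cuts_below C x = cuts_below C y"
    if "x \<le> y" "x \<in> B" "B \<in> P" "y \<in> {1..n}" for x y B
  proof
    assume y: "y \<in> B"
    \<comment> \<open>Convexity puts both \<open>c\<close> and \<open>Suc c\<close> into
      \<open>B\<close>, so \<open>c\<close> is not a cut.\<close>
    have "c \<notin> C" if "c \<in> {x..<y}" for c
    proof -
      have "c \<in> B" "Suc c \<in> B"
        using that y \<open>x \<in> B\<close> \<open>B \<in> P\<close> convex[of x c y B] convex[of x "Suc c" y B]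
        by (cases "x = c"; cases "Suc c = y"; simp)+
      then show ?thesis using \<open>B \<in> P\<close> unfolding C_def cuts_def by blast
    qed
    then show "cuts_below C x = cuts_below C y"
      using cuts_below_eq_iff[OF \<open>x \<le> y\<close>] by blast
  next
    have x: "x \<ge> 1" using un that by fastforce
    assume "cuts_below C x = cuts_below C y"
    then have none: "C \<inter> {x..<y} = {}" using cuts_below_eq_iff[OF \<open>x \<le> y\<close>] by blast
    have joined: "\<exists>B'\<in>P. m \<in> B' \<and> Suc m \<in> B'" if "x \<le> m" "m < y" for m
    proof -
      have "m \<notin> C" using none that by auto
      moreover have "m \<in> {1..<n}" using x \<open>y \<in> {1..n}\<close> that by simp
      ultimately show ?thesis unfolding C_def cuts_def by blast
    qed
    \<comment> \<open>Walk from \<open>x\<close> up to \<open>y\<close>: neighbours share some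
      block, and disjointness identifies it with \<open>B\<close> at each step. The bound
      \<open>m <= y\<close> sits inside the claim because the induction has no upper end.\<close>
    have "m \<le> y \<longrightarrow> m \<in> B" if "x \<le> m" for m
      using that
    proof (induction m rule: dec_induct)
      case base
      show ?case using \<open>x \<in> B\<close> by simp
    next
      case (step m)
      show ?case
      proof
        assume m: "Suc m \<le> y"
        then obtain B' where "B' \<in> P" "m \<in> B'" "Suc m \<in> B'" using joined[of m] step.hyps by auto
        moreover have "m \<in> B" using step.IH m by simp
        ultimately show "Suc m \<in> B" using disj[of B' B m] \<open>B \<in> P\<close> by simp
      qed
    qed
    then show "y \<in> B" using \<open>x \<le> y\<close> by simp
  qed
  have block: "layer n C (cuts_below C x) = B" if "x \<in> B" "B \<in> P" for x B
  proof -
    have "y \<in> B \<longleftrightarrow> cuts_below C x = cuts_below C y" if y: "y \<in> {1..n}" for y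
    proof (cases "x \<le> y")
      case True
      then show ?thesis using same_block \<open>x \<in> B\<close> \<open>B \<in> P\<close> y by blast
    next
      case False
      \<comment> \<open>\<open>same_block\<close> starts from the smaller element, here
        \<open>y\<close>; its block \<open>B'\<close> takes the role of \<open>B\<close>, and
        disjointness carries the result back.\<close>
      obtain B' where B': "B' \<in> P" "y \<in> B'" using un y by blast
      have "x \<in> {1..n}" using un \<open>x \<in> B\<close> \<open>B \<in> P\<close> by blast
      then have "x \<in> B' \<longleftrightarrow> cuts_below C y = cuts_below C x"
        using same_block[of y x B'] False B' by simp
      then show ?thesis using disj B' \<open>x \<in> B\<close> \<open>B \<in> P\<close> by metis
    qed
    moreover have "B \<subseteq> {1..n}" using un \<open>B \<in> P\<close> by blast
    ultimately show ?thesis unfolding layer_def by auto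
  qed
  have C: "C \<subseteq> {1..<n}" unfolding C_def cuts_def by blast
  show ?thesis
    unfolding C_def[symmetric]
  proof
    show "layered n C \<subseteq> P"
    proof
      fix A assume "A \<in> layered n C"
      then obtain j where j: "j \<le> card C" "A = layer n C j" by (auto simp: layered_def)
      then obtain x where x: "x \<in> {1..n}" "j = cuts_below C x"
        using layer_nonempty[OF n C] unfolding layer_def by blast
      then obtain B where "x \<in> B" "B \<in> P" using un by blast
      then show "A \<in> P" using block j x by metis
    qed
    show "P \<subseteq> layered n C"
    proof
      fix B assume B: "B \<in> P"
      then obtain x where x: "x \<in> B" using partition_onD3[OF P] by fastforce
      then have "x \<in> {1..n}" using un B by blast
      then show "B \<in> layered n C"
        using block[OF x B] cuts_below_le_card[OF n C] unfolding layered_def by blast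
    qed
  qed
qed

text \<open>\<open>cuts n\<close> is the inverse: one composite is \<open>cuts_layered\<close>, the
  other combines convexity of the blocks of an avoider with
  \<open>convex_partition_layered\<close>.\<close>

lemma bij_betw_layered:
  assumes "n \<ge> 1" "k \<ge> 1"
  shows "bij_betw (layered n) {C. C \<subseteq> {1..<n} \<and> card C = k - 1} (avoiders n k {{1, 3}, {2}})"
proof (rule bij_betw_byWitness[where f' = "cuts n"])
  show "\<forall>C\<in>{C. C \<subseteq> {1..<n} \<and> card C = k - 1}. cuts n (layered n C) = C"
    using cuts_layered[OF assms(1)] by blast
  show "layered n ` {C. C \<subseteq> {1..<n} \<and> card C = k - 1} \<subseteq> avoiders n k {{1, 3}, {2}}"
  proof
    fix P assume "P \<in> layered n ` {C. C \<subseteq> {1..<n} \<and> card C = k - 1}"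
    then obtain C where C: "C \<subseteq> {1..<n}" "card C = k - 1" "P = layered n C" by blast
    then show "P \<in> avoiders n k {{1, 3}, {2}}"
      using partition_on_layered[OF assms(1) C(1)] card_layered[OF assms(1) C(1)]
        layered_avoids[OF assms(1) C(1)] assms(2)
      unfolding avoiders_def by simp
  qed
  have layered_cuts: "layered n (cuts n P) = P" if "P \<in> avoiders n k {{1, 3}, {2}}" for P
  proof -
    have P: "partition_on {1..n} P" "\<not> contains_pattern n P {{1, 3}, {2}}"
      using that by (simp_all add: avoiders_def)
    show ?thesis
      using P(2) unfolding contains_13_2_iff[OF P(1)]
      by (intro convex_partition_layered[OF assms(1) P(1)]) blast
  qed
  then show "\<forall>P\<in>avoiders n k {{1, 3}, {2}}. layered n (cuts n P) = P" by blast
  show "cuts n ` avoiders n k {{1, 3}, {2}} \<subseteq> {C. C \<subseteq> {1..<n} \<and> card C = k - 1}"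
  proof
    fix C assume "C \<in> cuts n ` avoiders n k {{1, 3}, {2}}"
    then obtain P where P: "P \<in> avoiders n k {{1, 3}, {2}}" "C = cuts n P" by blast
    have sub: "C \<subseteq> {1..<n}" unfolding P(2) cuts_def by blast
    \<comment> \<open>The cuts are counted through the blocks: \<open>P\<close> equals
      \<open>layered n C\<close>, which has \<open>Suc (card C)\<close> blocks.\<close>
    moreover have "Suc (card C) = k"
      using card_layered[OF assms(1) sub] layered_cuts[OF P(1)] P by (simp add: avoiders_def)
    ultimately show "C \<in> {C. C \<subseteq> {1..<n} \<and> card C = k - 1}" by auto
  qed
qed

section \<open>The statistics of a weakly increasing word\<close>

lemma lb_sorted:
  assumes "sorted w"
  shows "lb w = 0"
proof -
  have "{w ! i | i. i < j \<and> w ! i > w ! j} = {}" if "j < length w" for j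
  proof -
    have "\<not> w ! i > w ! j" if "i < j" for i
      using sorted_nth_mono[OF assms, of i j] that \<open>j < length w\<close> by simp
    then show ?thesis by blast
  qed
  then show ?thesis
    unfolding lb_def by (intro sum.neutral ballI) (simp only: lessThan_iff card.empty)
qed

lemma rs_sorted:
  assumes "sorted w"
  shows "rs w = 0"
proof -
  have "{w ! i | i. j < i \<and> i < length w \<and> w ! i < w ! j} = {}" for j
  proof -
    have "\<not> w ! i < w ! j" if "j < i" "i < length w" for i
      using sorted_nth_mono[OF assms, of j i] that by simp
    then show ?thesis by blast
  qed
  then show ?thesis
    unfolding rs_def by (intro sum.neutral ballI) (simp only: card.empty)
qed

lemma ls_sorted:
  assumes "sorted w"
  shows "ls w = (\<Sum>a\<leftarrow>w. card {v \<in> set w. v < a})"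
proof -
  have "{w ! i | i. i < j \<and> w ! i < w ! j} = {v \<in> set w. v < w ! j}" if "j < length w" for j
  proof -
    have "i < j" if "i < length w" "w ! i < w ! j" for i
      using sorted_nth_mono[OF assms, of j i] that by (meson leD not_le_imp_less)
    moreover have "i < length w" if "i < j" for i using that \<open>j < length w\<close> by simp
    ultimately show ?thesis unfolding set_conv_nth by blast
  qed
  then show ?thesis
    unfolding ls_def by (auto simp only: sum_list_sum_nth atLeast0LessThan length_map nth_map
      lessThan_iff intro!: sum.cong)
qed

lemma rb_sorted:
  assumes "sorted w"
  shows "rb w = (\<Sum>a\<leftarrow>w. card {v \<in> set w. v > a})"
proof -
  have "{w ! i | i. j < i \<and> i < length w \<and> w ! i > w ! j} = {v \<in> set w. v > w ! j}"
    if "j < length w" for j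
  proof -
    have "j < i" if "i < length w" "w ! i > w ! j" for i
      using sorted_nth_mono[OF assms, of i j] that \<open>j < length w\<close> by (meson leD not_le_imp_less)
    then show ?thesis unfolding set_conv_nth by blast
  qed
  then show ?thesis by (simp add: rb_def sum_list_sum_nth atLeast0LessThan)
qed

lemma rgf_layered_statistics:
  assumes n: "n \<ge> 1" and C: "C \<subseteq> {1..<n}"
  shows "lb (rgf n (layered n C)) = 0" and "rs (rgf n (layered n C)) = 0"
    and "ls (rgf n (layered n C)) = (\<Sum>c\<in>C. n - c)"
    and "rb (rgf n (layered n C)) = \<Sum>C"
proof -
  let ?w = "rgf n (layered n C)"
  have fin: "finite C" using C finite_subset by blast
  have w: "?w = map (\<lambda>i. Suc (cuts_below C i)) [1..<Suc n]" by (rule rgf_layered[OF n C])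
  have sorted: "sorted ?w"
    unfolding w sorted_map
    by (rule sorted_wrt_mono_rel[OF _ sorted_wrt_upt]) (simp add: cuts_below_mono)
  show "lb ?w = 0" "rs ?w = 0" using sorted by (rule lb_sorted, rule rs_sorted)
  have "set ?w = Suc ` (cuts_below C ` {1..n})"
    by (auto simp: w simp del: upt_Suc)
  \<comment> \<open>No letter is skipped, so counting distinct smaller or larger letters amounts to
    measuring an interval of integers.\<close>
  then have set: "set ?w = {1..Suc (card C)}"
    using cuts_below_range[OF n C] by (simp add: image_Suc_atMost)
  have sum_w: "(\<Sum>a\<leftarrow>?w. g a) = (\<Sum>x\<in>{1..n}. g (Suc (cuts_below C x)))" for g :: "nat \<Rightarrow> nat"
  proof -
    have "(\<Sum>a\<leftarrow>?w. g a) = (\<Sum>x\<leftarrow>[1..<Suc n]. g (Suc (cuts_below C x)))"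
      by (simp add: w o_def del: upt_Suc)
    also have "\<dots> = (\<Sum>x\<in>{1..n}. g (Suc (cuts_below C x)))"
      by (simp add: sum_list_distinct_conv_sum_set atLeastLessThanSuc_atLeastAtMost del: upt_Suc)
    finally show ?thesis .
  qed
  have "ls ?w = (\<Sum>x\<in>{1..n}. card {c \<in> C. c < x})"
    unfolding ls_sorted[OF sorted] sum_w
  proof (rule sum.cong[OF refl])
    fix x assume "x \<in> {1..n}"
    then have "{v \<in> set ?w. v < Suc (cuts_below C x)} = {1..cuts_below C x}"
      using cuts_below_le_card[OF n C, of x] by (auto simp: set)
    then show "card {v \<in> set ?w. v < Suc (cuts_below C x)} = card {c \<in> C. c < x}"
      by (simp add: cuts_below_def)
  qed
  \<comment> \<open>Double counting of the pairs of a position \<open>x\<close> and a cut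
    \<open>c\<close> with \<open>c < x\<close>.\<close>
  also have "\<dots> = (\<Sum>c\<in>C. card {x \<in> {1..n}. c < x})"
    by (rule sum_multicount_gen) (use fin in auto)
  also have "\<dots> = (\<Sum>c\<in>C. n - c)"
  proof (rule sum.cong[OF refl])
    fix c
    have "{x \<in> {1..n}. c < x} = {Suc c..n}" by auto
    then show "card {x \<in> {1..n}. c < x} = n - c" by simp
  qed
  finally show "ls ?w = (\<Sum>c\<in>C. n - c)" .
  have "rb ?w = (\<Sum>x\<in>{1..n}. card {c \<in> C. x \<le> c})"
    unfolding rb_sorted[OF sorted] sum_w
  proof (rule sum.cong[OF refl])
    fix x assume "x \<in> {1..n}"
    have "{v \<in> set ?w. v > Suc (cuts_below C x)} = {Suc (Suc (cuts_below C x))..Suc (card C)}"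
      by (auto simp: set)
    \<comment> \<open>The number of larger letters is the number of cuts not below \<open>x\<close>;
      a cut at \<open>x\<close> itself is among them, since it ends the block of
      \<open>x\<close>.\<close>
    moreover have "card C = cuts_below C x + card {c \<in> C. x \<le> c}"
    proof -
      have "C = {c \<in> C. c < x} \<union> {c \<in> C. x \<le> c}" by auto
      then have "card C = card ({c \<in> C. c < x} \<union> {c \<in> C. x \<le> c})" by simp
      also have "\<dots> = card {c \<in> C. c < x} + card {c \<in> C. x \<le> c}"
        using fin by (intro card_Un_disjoint) auto
      finally show ?thesis by (simp add: cuts_below_def)
    qed
    ultimately show "card {v \<in> set ?w. v > Suc (cuts_below C x)} = card {c \<in> C. x \<le> c}" by simp
  qed
  also have "\<dots> = (\<Sum>c\<in>C. card {x \<in> {1..n}. x \<le> c})"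
    by (rule sum_multicount_gen) (use fin in auto)
  also have "\<dots> = \<Sum>C"
  proof (rule sum.cong[OF refl])
    fix c assume "c \<in> C"
    then have "{x \<in> {1..n}. x \<le> c} = {1..c}" using C by auto
    then show "card {x \<in> {1..n}. x \<le> c} = c" by simp
  qed
  finally show "rb ?w = \<Sum>C" .
qed

section \<open>Partitions into distinct parts as sets\<close>

lemma distinct_partitions_distinct: "ps \<in> distinct_partitions m k \<Longrightarrow> distinct ps"
  using strict_sorted_iff[of "rev ps"] by (simp add: distinct_partitions_def sorted_wrt_rev)

text \<open>A strictly decreasing list is determined by its set of entries; reversal reduces this to
  strictly increasing lists.\<close>

lemma bij_betw_set_distinct_partitions:
  "bij_betw set (distinct_partitions m k) {C. C \<subseteq> {1..m} \<and> card C = k}"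
proof (rule bij_betwI')
  fix ps qs assume "ps \<in> distinct_partitions m k" "qs \<in> distinct_partitions m k"
  then have "sorted_wrt (<) (rev ps)" "sorted_wrt (<) (rev qs)"
    by (simp_all add: distinct_partitions_def sorted_wrt_rev)
  then have "set ps = set qs \<Longrightarrow> rev ps = rev qs"
    by (intro strict_sorted_equal) simp_all
  then show "(set ps = set qs) = (ps = qs)" by auto
next
  fix ps assume ps: "ps \<in> distinct_partitions m k"
  then have "distinct ps" by (rule distinct_partitions_distinct)
  then show "set ps \<in> {C. C \<subseteq> {1..m} \<and> card C = k}"
    using ps by (auto simp: distinct_partitions_def distinct_card)
next
  fix C assume "C \<in> {C. C \<subseteq> {1..m} \<and> card C = k}"
  then have C: "C \<subseteq> {1..m}" "card C = k" "finite C" by (auto intro: finite_subset)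
  then have "rev (sorted_list_of_set C) \<in> distinct_partitions m k"
    by (auto simp: distinct_partitions_def sorted_wrt_rev)
  then show "\<exists>ps\<in>distinct_partitions m k. C = set ps"
    using C(3) by (intro bexI[of _ "rev (sorted_list_of_set C)"]) simp_all
qed

text \<open>The parts are the cuts, and \<open>k\<close> consecutive intervals have
  \<open>k - 1\<close> cuts between them. Hence there are \<open>k - 1\<close> parts, not
  \<open>k\<close>: for \<open>n = k = 1\<close> the left side is 1, but no positive part is at most
  0.\<close>

theorem theorem4p1:
  fixes n k :: nat and q r s t :: "'a::comm_semiring_1"
  assumes "n \<ge> 1" and "k \<ge> 1"
  shows "F n k {{1, 3}, {2}} q r s t =
    (\<Sum>ps\<in>distinct_partitions (n - 1) (k - 1).
       r ^ sum_list (complement_partition n ps) * s ^ sum_list ps)"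
proof -
  have interval: "{1..<n} = {1..n - 1}" using assms(1) by auto
  have "F n k {{1, 3}, {2}} q r s t =
    (\<Sum>C\<in>{C. C \<subseteq> {1..<n} \<and> card C = k - 1}. r ^ (\<Sum>c\<in>C. n - c) * s ^ \<Sum>C)"
    \<comment> \<open>The powers of \<open>q\<close> and \<open>t\<close> disappear because
      \<open>lb\<close> and \<open>rs\<close> are 0.\<close>
    unfolding F_def sum.reindex_bij_betw[OF bij_betw_layered[OF assms], symmetric]
    by (rule sum.cong[OF refl]) (simp add: rgf_layered_statistics[OF assms(1)])
  also have "\<dots> = (\<Sum>ps\<in>distinct_partitions (n - 1) (k - 1).
      r ^ (\<Sum>c\<in>set ps. n - c) * s ^ \<Sum>(set ps))"
    unfolding interval by (rule sum.reindex_bij_betw[OF bij_betw_set_distinct_partitions, symmetric])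
  also have "\<dots> = (\<Sum>ps\<in>distinct_partitions (n - 1) (k - 1).
      r ^ sum_list (complement_partition n ps) * s ^ sum_list ps)"
  \<comment> \<open>The parts are distinct, so sums over the list and over its set agree; the
    reversal in \<open>complement_partition\<close> does not affect the sum.\<close>
  proof (rule sum.cong[OF refl])
    fix ps assume "ps \<in> distinct_partitions (n - 1) (k - 1)"
    then have d: "distinct ps" by (rule distinct_partitions_distinct)
    show "r ^ (\<Sum>c\<in>set ps. n - c) * s ^ \<Sum>(set ps) =
        r ^ sum_list (complement_partition n ps) * s ^ sum_list ps"
      using sum_list_distinct_conv_sum_set[OF d, of "\<lambda>x. n - x"]
        sum_list_distinct_conv_sum_set[OF d, of "\<lambda>x. x"]
      by (simp add: complement_partition_def)
  qed
  finally show ?thesis .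
qed

end
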